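(* Let $f:[0,1]\to[0,1]$ be a transitive continuous map. Then one of the following possibilities holds: 1) the map $f$ is mixing and, moreover, for any $\eta>0$ and any non-degenerate interval $U$ there exists $n_0$ such that $f^nU\supset[\eta,1-\eta]$ for any $n>n_0$; 2) the map $f$ is not mixing and, moreover, there exists a fixed point $a\in(0,1)$ such that $f[0,a]=[a,1]$, $f[a,1]=[0,a]$, and $f^2|[0,a]$ and $f^2|[a,1]$ are mixing. In any case $\overline{\mathrm{Per}\,f}=[0,1]$.
   Context: A continuous map $T:X\to X$ of a compact metric space is transitive if there is $x$ with $\omega(x)=X$ (where $\omega(x)$ is the set of limit points of the forward orbit of $x$), and mixing if for any nonempty open $U,V$ there is $N$ with $T^nU\cap V\ne\emptyset$ for all $n>N$. $\mathrm{Per}\,f$ is the set of periodic points of $f$. *)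

theory Defs
  imports "HOL-Analysis.Analysis"
begin

text \<open>
  A map \<open>T : X \<rightarrow> X\<close> of a metric space is rendered as a total function \<open>T\<close> on the ambient type
  together with the carrier set \<open>X\<close>; only the values of \<open>T\<close> on \<open>X\<close> matter. Compactness of \<open>X\<close>,
  continuity of \<open>T\<close> on \<open>X\<close> and invariance of \<open>X\<close> are not part of the predicates below, but
  are to be assumed where they are used. Iterates are \<open>T ^^ n\<close>.
\<close>

text \<open>
  Limit points are those of the orbit as a sequence, i.e. subsequential limits, so the
  \<open>\<omega>\<close>-limit set of a periodic point is its orbit.
\<close>

definition omega_limit :: "('a::metric_space \<Rightarrow> 'a) \<Rightarrow> 'a \<Rightarrow> 'a set" where
  "omega_limit T x =
     {y. \<exists>r :: nat \<Rightarrow> nat. strict_mono r \<and> (\<lambda>k. (T ^^ r k) x) \<longlonglongrightarrow> y}"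

definition transitive_on :: "'a::metric_space set \<Rightarrow> ('a \<Rightarrow> 'a) \<Rightarrow> bool" where
  "transitive_on X T \<longleftrightarrow> (\<exists>x\<in>X. omega_limit T x = X)"

text \<open>Open sets are those of the subspace \<open>X\<close>.\<close>

definition mixing_on :: "'a::metric_space set \<Rightarrow> ('a \<Rightarrow> 'a) \<Rightarrow> bool" where
  "mixing_on X T \<longleftrightarrow>
     (\<forall>U V. openin (top_of_set X) U \<and> openin (top_of_set X) V \<and> U \<noteq> {} \<and> V \<noteq> {} \<longrightarrow>
        (\<exists>N::nat. \<forall>n>N. (T ^^ n) ` U \<inter> V \<noteq> {}))"

definition periodic_points :: "'a set \<Rightarrow> ('a \<Rightarrow> 'a) \<Rightarrow> 'a set" where
  "periodic_points X T = {x \<in> X. \<exists>n>0. (T ^^ n) x = x}"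

end

theory Submission
  imports Defs
begin

text \<open>
  Periodic points are dense, because in an interval without periodic points all returns would go
  in the same direction, which contradicts recurrence of a dense orbit.

  If no proper non-degenerate closed interval is mapped into itself by a power of \<open>f\<close>, then for
  every non-degenerate interval \<open>U\<close> and suitable \<open>k\<close> the sets \<open>f\<^bsup>kn\<^esup> U\<close> share a periodic point
  of \<open>U\<close>, so their union is an interval whose closure is everything. Hence every periodic point in
  the interior eventually belongs to all images of \<open>U\<close>; two such points near the endpoints
  give the covering property and mixing.

  Otherwise some proper closed interval is periodic; its images cover the whole interval and all contain
  an interior fixed point \<open>c\<close>. Comparing the one-sided germs of these images at \<open>c\<close> shows that \<open>f\<close>
  exchanges the two sides of \<open>c\<close>. On each side \<open>f\<^sup>2\<close> is transitive and fixes the endpoint \<open>c\<close>, so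
  it cannot exchange the two sides of an interior point, and the first alternative applies to it.
\<close>

section \<open>Iterates and relatively open sets\<close>

lemma funpow_funpow: "(f ^^ m) ((f ^^ n) x) = (f ^^ (m + n)) x"
  by (simp add: funpow_add)

lemma openin_interval_contains_interval:
  fixes l r :: real
  assumes "openin (top_of_set {l..r}) U" "U \<noteq> {}" "l < r"
  obtains u v where "u < v" "{u..v} \<subseteq> U" "l \<le> u" "v \<le> r"
proof -
  obtain x where x: "x \<in> U" using assms by auto
  obtain e where e: "e > 0" "ball x e \<inter> {l..r} \<subseteq> U"
    using assms(1) x unfolding openin_contains_ball by blast
  have xI: "l \<le> x" "x \<le> r" using assms(1) x openin_imp_subset by fastforce+
  show thesis
  proof (cases "x < r")
    case True
    have "{x..min r (x + e/2)} \<subseteq> ball x e \<inter> {l..r}"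
      using e xI by (auto simp: dist_real_def)
    then have "{x..min r (x + e/2)} \<subseteq> U" using e(2) by blast
    then show thesis using that[of x "min r (x + e/2)"] True e(1) xI by auto
  next
    case False
    then have "x = r" using xI by auto
    have "{max l (r - e/2)..r} \<subseteq> ball x e \<inter> {l..r}"
      using e xI \<open>x = r\<close> by (auto simp: dist_real_def)
    then have "{max l (r - e/2)..r} \<subseteq> U" using e(2) by blast
    then show thesis using that[of "max l (r - e/2)" r] assms(3) e(1) by auto
  qed
qed

section \<open>Interval maps with a recurrent dense orbit\<close>

text \<open>The endpoints are arbitrary because the results are applied to \<open>f\<close> on the
  unit interval and to \<open>f ^^ 2\<close> on both sides of a fixed point. Transitivity enters as
  late visits of one orbit to every open subinterval, a form that passes easily to
  \<open>f ^^ 2\<close>.\<close>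

locale transitive_interval_map =
  fixes f :: "real \<Rightarrow> real" and l r x0 :: real
  assumes less: "l < r"
    and cont: "continuous_on {l..r} f"
    and maps: "f ` {l..r} \<subseteq> {l..r}"
    and x0: "x0 \<in> {l..r}"
    and visits: "\<And>u v N. l \<le> u \<Longrightarrow> u < v \<Longrightarrow> v \<le> r \<Longrightarrow> \<exists>n\<ge>N. (f ^^ n) x0 \<in> {u<..<v}"
begin

lemma maps_bounds: "l \<le> x \<Longrightarrow> x \<le> r \<Longrightarrow> l \<le> f x \<and> f x \<le> r"
  using maps by (auto simp: image_subset_iff)

lemma funpow_maps: "x \<in> {l..r} \<Longrightarrow> (f ^^ n) x \<in> {l..r}"
  by (induction n) (use maps_bounds in auto)

lemma funpow_maps_image: "A \<subseteq> {l..r} \<Longrightarrow> (f ^^ n) ` A \<subseteq> {l..r}"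
  using funpow_maps by blast

lemma funpow_cont: "continuous_on {l..r} (f ^^ n)"
proof (induction n)
  case (Suc n)
  have "continuous_on ((f ^^ n) ` {l..r}) f"
    using continuous_on_subset[OF cont] funpow_maps_image[of "{l..r}" n] by simp
  then have "continuous_on {l..r} (f \<circ> (f ^^ n))"
    by (rule continuous_on_compose[OF Suc])
  then show ?case by simp
qed (simp add: id_def)

lemma closed_eventually_orbit:
  assumes "closed Y" "\<And>n. n \<ge> N \<Longrightarrow> (f ^^ n) x0 \<in> Y"
  shows "{l..r} \<subseteq> Y"
proof -
  have "y \<in> Y" if y: "y \<in> {l<..<r}" for y
  proof (rule ccontr)
    assume "y \<notin> Y"
    then obtain e where e: "e > 0" "ball y e \<subseteq> - Y"
      using assms(1) by (meson ComplI closed_def openE)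
    obtain n where n: "n \<ge> N" "(f ^^ n) x0 \<in> {max l (y - e)<..<min r (y + e)}"
      using visits[of "max l (y - e)" "min r (y + e)" N] y e by auto
    then have "(f ^^ n) x0 \<in> ball y e" by (auto simp: dist_real_def)
    with e n assms show False by auto
  qed
  then have "closure {l<..<r} \<subseteq> Y" using assms(1) by (intro closure_minimal) auto
  then show ?thesis using less by simp
qed

text \<open>The dense orbit enters \<open>{u<..<v}\<close> and can never leave \<open>Y\<close>
  afterwards, so \<open>Y\<close> contains a tail of the orbit, which is still dense.\<close>

lemma closed_invariant_full:
  assumes "closed Y" "f ` (Y \<inter> {l..r}) \<subseteq> Y" "l \<le> u" "u < v" "v \<le> r" "{u<..<v} \<subseteq> Y"
  shows "{l..r} \<subseteq> Y"
proof -
  obtain N where N: "(f ^^ N) x0 \<in> {u<..<v}" using visits[of u v 0] assms by auto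
  have "(f ^^ n) x0 \<in> Y" if "n \<ge> N" for n
    using that
  proof (induction n rule: dec_induct)
    case base
    then show ?case using N assms by auto
  next
    case (step n)
    then show ?case using assms(2) funpow_maps[OF x0, of n] by auto
  qed
  then show ?thesis using closed_eventually_orbit assms(1) by blast
qed

text \<open>The image is compact and contains the orbit from time 1 on.\<close>

lemma surj: "f ` {l..r} = {l..r}"
proof
  have "compact (f ` {l..r})" using cont by (intro compact_continuous_image) auto
  moreover have "(f ^^ n) x0 \<in> f ` {l..r}" if n: "n \<ge> 1" for n
  proof -
    obtain m where "n = Suc m" using n by (cases n) auto
    then show ?thesis using funpow_maps[OF x0, of m] by auto
  qed
  ultimately show "{l..r} \<subseteq> f ` {l..r}"
    using closed_eventually_orbit[of "f ` {l..r}" 1] compact_imp_closed by auto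
qed (rule maps)

section \<open>Density of periodic points and an interior fixed point\<close>

text \<open>By the intermediate value theorem, a displacement without zeros keeps its sign.\<close>

lemma funpow_sign:
  assumes "l \<le> u" "v \<le> r" "\<And>x. x \<in> {u<..<v} \<Longrightarrow> (f ^^ n) x \<noteq> x"
    and "a \<in> {u<..<v}" "(f ^^ n) a > a" "b \<in> {u<..<v}"
  shows "(f ^^ n) b > b"
proof (rule ccontr)
  assume neg: "\<not> (f ^^ n) b > b"
  let ?g = "\<lambda>x. (f ^^ n) x - x"
  have sub: "{u<..<v} \<subseteq> {l..r}" using assms by auto
  then have "continuous_on {u<..<v} ?g"
    by (intro continuous_intros continuous_on_subset[OF funpow_cont])
  then have "connected (?g ` {u<..<v})" by (intro connected_continuous_image) auto
  moreover have "?g b \<in> ?g ` {u<..<v}" "?g a \<in> ?g ` {u<..<v}" using assms by auto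
  moreover have "?g b \<le> 0" "0 \<le> ?g a" using neg assms by auto
  ultimately have "0 \<in> ?g ` {u<..<v}" using connectedD_interval by blast
  then obtain x where "x \<in> {u<..<v}" "?g x = 0" by auto
  with assms(3)[of x] show False by simp
qed

lemma funpow_sign':
  assumes "l \<le> u" "v \<le> r" "\<And>x. x \<in> {u<..<v} \<Longrightarrow> (f ^^ n) x \<noteq> x"
    and "a \<in> {u<..<v}" "(f ^^ n) a < a" "b \<in> {u<..<v}"
  shows "(f ^^ n) b < b"
  using funpow_sign[OF assms(1-3) assms(6) _ assms(4)] assms(3)[OF assms(6)] assms(5)
  by (cases "(f ^^ n) b > b") auto

lemma exists_periodic:
  assumes "l \<le> u" "u < v" "v \<le> r"
  shows "\<exists>x\<in>{u<..<v}. \<exists>n>0. (f ^^ n) x = x"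
proof (rule ccontr)
  assume "\<not> ?thesis"
  then have np: "(f ^^ n) x \<noteq> x" if "x \<in> {u<..<v}" "n > 0" for x n using that by blast
  let ?J = "{u<..<v}"
  \<comment> \<open>Only the first return must lie in \<open>?J\<close>: the upward displacement of
    \<open>f ^^ (m * Suc k)\<close> at \<open>x\<close> transfers to the point
    \<open>(f ^^ m) x\<close>, which is already above \<open>x\<close>.\<close>
  have up: "(f ^^ (m * Suc k)) x > x"
    if "x \<in> ?J" "(f ^^ m) x \<in> ?J" "(f ^^ m) x > x" "m > 0" for x m k
  proof (induction k)
    case (Suc k)
    have "(f ^^ (m * Suc k)) ((f ^^ m) x) > (f ^^ m) x"
      using funpow_sign[OF assms(1,3), of "m * Suc k" x "(f ^^ m) x"] np Suc that by auto
    moreover have "(f ^^ (m * Suc k)) ((f ^^ m) x) = (f ^^ (m * Suc (Suc k))) x"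
      by (simp only: funpow_funpow mult_Suc_right add_ac)
    ultimately show ?case using that by simp
  qed (use that in simp)
  have down: "(f ^^ (m * Suc k)) x < x"
    if "x \<in> ?J" "(f ^^ m) x \<in> ?J" "(f ^^ m) x < x" "m > 0" for x m k
  proof (induction k)
    case (Suc k)
    have "(f ^^ (m * Suc k)) ((f ^^ m) x) < (f ^^ m) x"
      using funpow_sign'[OF assms(1,3), of "m * Suc k" x "(f ^^ m) x"] np Suc that by auto
    moreover have "(f ^^ (m * Suc k)) ((f ^^ m) x) = (f ^^ (m * Suc (Suc k))) x"
      by (simp only: funpow_funpow mult_Suc_right add_ac)
    ultimately show ?case using that by simp
  qed (use that in simp)
  \<comment> \<open>An upward return time \<open>m\<close> and a downward return time \<open>n\<close> conflict at time \<open>m n\<close>.\<close>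
  have no_both: False
    if "x \<in> ?J" "(f ^^ m) x \<in> ?J" "(f ^^ m) x > x" "m > 0"
      "y \<in> ?J" "(f ^^ n) y \<in> ?J" "(f ^^ n) y < y" "n > 0" for x y m n
  proof -
    have "(f ^^ (m * n)) x > x" using up[of x m "n - 1"] that by auto
    moreover have "(f ^^ (m * n)) y < y" using down[of y n "m - 1"] that by (auto simp: mult.commute)
    moreover have "m * n > 0" using that by simp
    ultimately show False
      using funpow_sign[OF assms(1,3) np that(1) _ that(5), of "m * n"] by simp
  qed
  have shift: "(f ^^ (j - i)) ((f ^^ i) x0) = (f ^^ j) x0" if "i < j" for i j
    using that by (simp add: funpow_funpow)
  obtain a where a: "(f ^^ a) x0 \<in> ?J" using visits[OF assms, of 0] by auto
  obtain b where b: "b > a" "(f ^^ b) x0 \<in> ?J" using visits[OF assms, of "Suc a"] Suc_le_lessD by blast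
  have ne: "(f ^^ b) x0 \<noteq> (f ^^ a) x0" using np[OF a, of "b - a"] shift[OF b(1)] b by auto
  then consider "(f ^^ b) x0 > (f ^^ a) x0" | "(f ^^ b) x0 < (f ^^ a) x0" by linarith
  then show False
  proof cases
    case 1
    \<comment> \<open>The orbit rose from time \<open>a\<close> to time \<open>b\<close>; a later
      visit below its position at time \<open>b\<close> is a downward return, as
      \<open>no_both\<close> requires.\<close>
    obtain d where d: "d > b" "(f ^^ d) x0 \<in> {u<..<(f ^^ b) x0}"
      using visits[of u "(f ^^ b) x0" "Suc b"] assms b
      by (meson Suc_le_lessD greaterThanLessThan_iff less_imp_le order.trans)
    show False
      using no_both[of "(f ^^ a) x0" "b - a" "(f ^^ b) x0" "d - b"] a b d 1
        shift[OF b(1)] shift[OF d(1)] by simp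
  next
    case 2
    obtain d where d: "d > b" "(f ^^ d) x0 \<in> {(f ^^ b) x0<..<v}"
      using visits[of "(f ^^ b) x0" v "Suc b"] assms b
      by (meson Suc_le_lessD greaterThanLessThan_iff less_imp_le order.trans)
    show False
      using no_both[of "(f ^^ b) x0" "d - b" "(f ^^ a) x0" "b - a"] a b d 2
        shift[OF b(1)] shift[OF d(1)] by simp
  qed
qed

lemma closure_periodic_points: "closure (periodic_points {l..r} f) = {l..r}"
proof
  have "periodic_points {l..r} f \<subseteq> {l..r}" by (auto simp: periodic_points_def)
  then show "closure (periodic_points {l..r} f) \<subseteq> {l..r}"
    by (intro closure_minimal) auto
  have "y \<in> closure (periodic_points {l..r} f)" if y: "y \<in> {l<..<r}" for y
    unfolding closure_approachable
  proof (intro allI impI)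
    fix e :: real assume "e > 0"
    then obtain x n where "x \<in> {max l (y - e)<..<min r (y + e)}" "n > 0" "(f ^^ n) x = x"
      using exists_periodic[of "max l (y - e)" "min r (y + e)"] y by auto
    then show "\<exists>x\<in>periodic_points {l..r} f. dist x y < e"
      by (intro bexI[of _ x]) (auto simp: periodic_points_def dist_real_def)
  qed
  then have "closure {l<..<r} \<subseteq> closure (periodic_points {l..r} f)"
    by (intro closure_minimal) auto
  then show "{l..r} \<subseteq> closure (periodic_points {l..r} f)" using less by simp
qed

lemma interior_fixed_point: "\<exists>c. l < c \<and> c < r \<and> f c = c"
proof (rule ccontr)
  assume "\<not> ?thesis"
  then have nf: "\<And>x. x \<in> {l<..<r} \<Longrightarrow> (f ^^ 1) x \<noteq> x" by auto
  define m where "m = (l + r) / 2"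
  have m: "m \<in> {l<..<r}" "l < m" "m < r" using less by (auto simp: m_def field_simps)
  then consider "(f ^^ 1) m > m" | "(f ^^ 1) m < m" using nf[of m] by fastforce
  then show False
  proof cases
    case 1
    have gt: "f y > y" if "y \<in> {l<..<r}" for y
      using funpow_sign[OF _ _ nf m(1) 1 that] by simp
    have "f ` {m..<r} \<subseteq> {m..r}"
      unfolding image_subset_iff
    proof
      fix x assume x: "x \<in> {m..<r}"
      show "f x \<in> {m..r}" using gt[of x] maps_bounds[of x] x m by auto
    qed
    \<comment> \<open>The sign is known only in the open interval; continuity adds the endpoint
      \<open>r\<close>.\<close>
    then have "f ` closure {m..<r} \<subseteq> {m..r}"
      using m by (intro image_closure_subset continuous_on_subset[OF cont]) auto
    then have "{l..r} \<subseteq> {m..r}"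
      using m by (intro closed_invariant_full[of _ m r]) auto
    then show False using m by auto
  next
    case 2
    have lt: "f y < y" if "y \<in> {l<..<r}" for y
      using funpow_sign'[OF _ _ nf m(1) 2 that] by simp
    have "f ` {l<..m} \<subseteq> {l..m}"
      unfolding image_subset_iff
    proof
      fix x assume x: "x \<in> {l<..m}"
      show "f x \<in> {l..m}" using lt[of x] maps_bounds[of x] x m by auto
    qed
    then have "f ` closure {l<..m} \<subseteq> {l..m}"
      using m by (intro image_closure_subset continuous_on_subset[OF cont]) auto
    then have "{l..r} \<subseteq> {l..m}"
      using m by (intro closed_invariant_full[of _ l m]) auto
    then show False using m by auto
  qed
qed

lemma funpow_periodic: "(f ^^ k) x = x \<Longrightarrow> (f ^^ (k * i)) x = x"
  by (induction i) (simp_all add: funpow_add)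

text \<open>The iterate of order \<open>m * n * j\<close> fixes both points and factors through
  \<open>f ^^ j\<close>.\<close>

lemma periodic_funpow_inj:
  assumes "(f ^^ m) x = x" "m > 0" "(f ^^ n) y = y" "n > 0" "(f ^^ j) x = (f ^^ j) y"
  shows "x = y"
proof -
  have "j \<le> m * n * j" using assms by simp
  then have eq: "(f ^^ (m * n * j - j)) ((f ^^ j) z) = (f ^^ (m * n * j)) z" for z
    by (simp add: funpow_funpow)
  have "(f ^^ (m * n * j)) x = x" using funpow_periodic[OF assms(1), of "n * j"] by (simp add: mult.assoc)
  moreover have "(f ^^ (m * n * j)) y = y"
    using funpow_periodic[OF assms(3), of "m * j"] by (simp add: mult.assoc mult.left_commute)
  ultimately show ?thesis using eq[of x] eq[of y] unfolding assms(5) by (simp only:)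
qed

text \<open>The interval contains two distinct periodic points, and iterates never identify
  them.\<close>

lemma funpow_image_nondegenerate:
  assumes "l \<le> u" "u < v" "v \<le> r"
  shows "\<exists>x\<in>{u<..<v}. \<exists>y\<in>{u<..<v}. (f ^^ j) x < (f ^^ j) y"
proof -
  obtain x m where x: "x \<in> {u<..<v}" "m > 0" "(f ^^ m) x = x"
    using exists_periodic[OF assms] by blast
  obtain y n where y: "y \<in> {u<..<x}" "n > 0" "(f ^^ n) y = y"
    using exists_periodic[of u x] assms x(1) by auto
  have "(f ^^ j) x \<noteq> (f ^^ j) y" using periodic_funpow_inj[of m x n y j] x y by auto
  moreover have "y \<in> {u<..<v}" using x(1) y(1) by auto
  ultimately show ?thesis using x(1) by (meson linorder_neqE_linordered_idom)
qed

section \<open>Periodic intervals and the exchange of sides\<close>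

lemma closed_invariant_right_germ:
  assumes "closed Y" "f ` Y \<subseteq> Y" "\<forall>\<^sub>F x in at_right c. x \<in> Y" "l \<le> c" "c < r"
  shows "{l..r} \<subseteq> Y"
proof -
  obtain b where b: "b > c" "\<And>x. c < x \<Longrightarrow> x < b \<Longrightarrow> x \<in> Y"
    using assms(3,5) unfolding eventually_at_right[OF assms(5)] by auto
  show ?thesis
    by (rule closed_invariant_full[of Y c "min b r"]) (use assms b in auto)
qed

lemma closed_invariant_left_germ:
  assumes "closed Y" "f ` Y \<subseteq> Y" "\<forall>\<^sub>F x in at_left c. x \<in> Y" "l < c" "c \<le> r"
  shows "{l..r} \<subseteq> Y"
proof -
  obtain b where b: "b < c" "\<And>x. b < x \<Longrightarrow> x < c \<Longrightarrow> x \<in> Y"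
    using assms(3,4) unfolding eventually_at_left[OF assms(4)] by auto
  show ?thesis
    by (rule closed_invariant_full[of Y "max b l" c]) (use assms b in auto)
qed

text \<open>
  The filter \<open>F\<close> is a one-sided germ at an interior fixed point and \<open>A\<close> is the opposite side.
  Intersecting the shifts of the cycle \<open>C\<close> by all indices that carry the germ yields a finer cycle \<open>D\<close>
  which still covers the interval. If \<open>D j\<close> leaves \<open>A\<close>, then \<open>j\<close> stabilizes the set \<open>S\<close>
  of indices carrying the germ; were this so for both \<open>j\<close> and \<open>Suc j\<close>, then \<open>S\<close> would contain all
  indices.
\<close>

lemma cycle_exchange:
  fixes C :: "nat \<Rightarrow> real set" and F :: "real filter"
  assumes k: "k > 0" and per: "\<And>j. C (j + k) = C j"
    and clos: "\<And>j. closed (C j)" and inv: "\<And>j. f ` C j \<subseteq> C (Suc j)"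
    and germ: "\<And>j. \<not> (\<forall>\<^sub>F x in F. x \<in> C j) \<Longrightarrow> C j \<subseteq> A"
    and j0: "\<forall>\<^sub>F x in F. x \<in> C j0" and j1: "\<not> (\<forall>\<^sub>F x in F. x \<in> C j1)"
    and full: "\<And>Y. closed Y \<Longrightarrow> f ` Y \<subseteq> Y \<Longrightarrow> \<forall>\<^sub>F x in F. x \<in> Y \<Longrightarrow> {l..r} \<subseteq> Y"
    and x: "x \<in> {l..r}" "x \<notin> A"
  shows "f x \<in> A"
proof (rule ccontr)
  assume fx: "f x \<notin> A"
  define S where "S = {j. \<forall>\<^sub>F x in F. x \<in> C j}"
  define D where "D j = (\<Inter>i\<in>S. C (i + j))" for j
  have perm: "C (j + m * k) = C j" for j m
  proof (induction m)
    case (Suc m)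
    have "j + Suc m * k = (j + m * k) + k" by simp
    then show ?case using per[of "j + m * k"] Suc by metis
  qed simp
  have Cmod: "C (j mod k) = C j" for j
    using perm[of "j mod k" "j div k"] by (simp add: add.commute)
  have Sper: "j + m * k \<in> S \<longleftrightarrow> j \<in> S" for j m by (simp add: S_def perm)
  \<comment> \<open>\<open>S\<close> is infinite but invariant under shifts by \<open>k\<close>, so
    finitely many residues suffice and the germ passes to the whole intersection
    \<open>D 0\<close>.\<close>
  have "\<forall>\<^sub>F x in F. \<forall>i\<in>S \<inter> {..<k}. x \<in> C i"
    by (rule eventually_ball_finite) (auto simp: S_def)
  then have D0: "\<forall>\<^sub>F x in F. x \<in> D 0"
  proof (rule eventually_mono)
    fix x assume *: "\<forall>i\<in>S \<inter> {..<k}. x \<in> C i"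
    have "x \<in> C i" if "i \<in> S" for i
    proof -
      have "i mod k \<in> S \<inter> {..<k}" using that k by (simp add: S_def Cmod)
      then show ?thesis using * Cmod by blast
    qed
    then show "x \<in> D 0" by (simp add: D_def)
  qed
  have Dk: "D k = D 0" by (simp add: D_def per)
  have Dinv: "f y \<in> D (Suc j)" if "y \<in> D j" for y j
    using that inv by (simp add: D_def image_subset_iff)
  have "{l..r} \<subseteq> (\<Union>j<k. D j)"
  proof (rule full)
    show "closed (\<Union>j<k. D j)" unfolding D_def by (intro closed_UN closed_INT ballI clos) auto
    show "f ` (\<Union>j<k. D j) \<subseteq> (\<Union>j<k. D j)"
    proof clarify
      fix y j assume "j < k" "y \<in> D j"
      then have "f y \<in> D (Suc j)" "Suc j < k \<or> Suc j = k" using Dinv by auto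
      then show "f y \<in> (\<Union>j<k. D j)" using Dk k by auto
    qed
    show "\<forall>\<^sub>F x in F. x \<in> (\<Union>j<k. D j)" using D0 by (rule eventually_mono) (use k in auto)
  qed
  then obtain j where j: "x \<in> D j" using x by auto
  \<comment> \<open>A member of the cycle containing a point outside \<open>A\<close> must carry the
    germ.\<close>
  have stab: "i + j \<in> S" if "i \<in> S" for i
  proof -
    have "x \<in> C (i + j)" using that j by (simp add: D_def)
    then show ?thesis using germ[of "i + j"] x(2) by (auto simp: S_def)
  qed
  have stab': "i + Suc j \<in> S" if "i \<in> S" for i
  proof -
    have "f x \<in> C (i + Suc j)" using that Dinv[OF j] by (simp add: D_def)
    then show ?thesis using germ[of "i + Suc j"] fx by (auto simp: S_def)
  qed
  have stabm: "i + m * j \<in> S" if "i \<in> S" for i m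
  proof (induction m)
    case (Suc m)
    have "i + Suc m * j = (i + m * j) + j" by simp
    then show ?case using stab[OF Suc] by metis
  qed (use that in simp)
  \<comment> \<open>Adding \<open>j\<close> exactly \<open>k - 1\<close> times and
    \<open>Suc j\<close> once shifts the index by 1 plus a multiple of the period.\<close>
  have stab1: "Suc i \<in> S" if "i \<in> S" for i
  proof -
    have "i + (k - 1) * j + Suc j \<in> S" using stab' stabm that by blast
    moreover have "i + (k - 1) * j + Suc j = Suc i + j * k" using k by (cases k) auto
    ultimately show ?thesis using Sper by metis
  qed
  have "j0 + m \<in> S" for m
    by (induction m) (use stab1 j0 in \<open>auto simp: S_def\<close>)
  \<comment> \<open>Shifting \<open>j1\<close> by \<open>j0\<close> periods makes it reachable from
    \<open>j0\<close> by unit steps.\<close>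
  moreover have "j0 \<le> j1 + j0 * k" using k by (simp add: trans_le_add2)
  ultimately have "j1 + j0 * k \<in> S" by (metis le_add_diff_inverse)
  then show False using Sper j1 by (simp add: S_def)
qed

text \<open>The images of \<open>C\<close> form a cycle of intervals covering everything, so one of
  them, and hence each, contains the fixed point \<open>c\<close>. Such an interval either carries a
  given one-sided germ at \<open>c\<close> or lies on the opposite side, which is the input of
  \<open>cycle_exchange\<close>, used once per side.\<close>

lemma periodic_interval_exchange:
  assumes k: "k > 0" and C: "closed C" "is_interval C" "C \<subseteq> {l..r}" "C \<noteq> {l..r}"
    and uv: "u < v" "u \<in> C" "v \<in> C" and inv: "(f ^^ k) ` C \<subseteq> C"
    and c: "l < c" "c < r" "f c = c"
  shows "f ` {l..c} \<subseteq> {c..r} \<and> f ` {c..r} \<subseteq> {l..c}"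
proof -
  \<comment> \<open>Reducing the exponent modulo \<open>k\<close> makes the family exactly periodic
    even if \<open>f ^^ k\<close> maps \<open>C\<close> onto a smaller set; the wrap-around is then
    only an inclusion.\<close>
  define E where "E j = (f ^^ (j mod k)) ` C" for j
  have contC: "continuous_on C (f ^^ n)" for n
    using funpow_cont C(3) continuous_on_subset by blast
  have "compact C" using C(1,3) compact_Icc by (metis Int_absorb1 closed_Int_compact inf_commute)
  then have Ecl: "closed (E j)" for j
    unfolding E_def by (intro compact_imp_closed compact_continuous_image contC)
  have Eint: "is_interval (E j)" for j
    unfolding E_def using C(2) contC connected_continuous_image is_interval_connected_1 by blast
  have Esub: "E j \<subseteq> {l..r}" for j
    unfolding E_def using C(3) by (rule funpow_maps_image)
  have Einv: "f ` E j \<subseteq> E (Suc j)" for j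
  proof -
    have eq: "f ` E j = (f ^^ Suc (j mod k)) ` C" by (simp add: E_def image_comp)
    show ?thesis
    proof (cases "Suc (j mod k) = k")
      case True
      then show ?thesis using inv eq by (simp add: E_def mod_Suc del: funpow.simps)
    next
      case False
      then show ?thesis using eq by (simp add: E_def mod_Suc del: funpow.simps)
    qed
  qed
  have Eper: "E (j + m * k) = E j" for j m by (simp add: E_def)
  have Ek: "E (j + k) = E j" for j using Eper[of j 1] by simp
  have uvC: "{u..v} \<subseteq> C" using uv C(2) by (metis atLeastAtMost_iff is_interval_1 subsetI)
  have E0: "E 0 = C" using k by (simp add: E_def)
  have "{l..r} \<subseteq> (\<Union>j<k. E j)"
  proof (rule closed_invariant_full[of _ u v])
    show "closed (\<Union>j<k. E j)" using Ecl by auto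
    show "f ` ((\<Union>j<k. E j) \<inter> {l..r}) \<subseteq> (\<Union>j<k. E j)"
    proof clarify
      fix y j assume "j < k" "y \<in> E j"
      then have "f y \<in> E (Suc j)" "Suc j < k \<or> Suc j = k" using Einv by auto
      then show "f y \<in> (\<Union>j<k. E j)" using Ek[of 0] k by auto
    qed
    show "{u<..<v} \<subseteq> (\<Union>j<k. E j)"
    proof
      fix y assume "y \<in> {u<..<v}"
      then have "y \<in> E 0" using uvC E0 by auto
      then show "y \<in> (\<Union>j<k. E j)" using k by blast
    qed
  qed (use uv C(3) in auto)
  moreover have "c \<in> {l..r}" using c by simp
  ultimately obtain i where i: "c \<in> E i" by blast
  have step: "c \<in> E (i + m)" for m
  proof (induction m)
    case (Suc m)
    then have "f c \<in> E (Suc (i + m))" using Einv by blast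
    then show ?case using c(3) by simp
  qed (use i in simp)
  \<comment> \<open>The \<open>i * k\<close> added here keeps the subtraction of \<open>i\<close>
    from truncating.\<close>
  have cE: "c \<in> E j" for j
    using step[of "j + i * k - i"] Eper[of j i] k by (simp add: trans_le_add2)
  have nondeg: "\<exists>y\<in>E j. y \<noteq> c" for j
  proof (rule ccontr)
    assume "\<not> ?thesis"
    moreover obtain x y where "x \<in> {u<..<v}" "y \<in> {u<..<v}" "(f ^^ (j mod k)) x < (f ^^ (j mod k)) y"
      using funpow_image_nondegenerate[of u v "j mod k"] uv C(3) by fastforce
    moreover from this have "x \<in> C" "y \<in> C" using uvC by auto
    ultimately show False by (auto simp: E_def)
  qed
  have right: "E j \<subseteq> {l..c}" if "\<not> (\<forall>\<^sub>F x in at_right c. x \<in> E j)" for j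
  proof
    fix y assume y: "y \<in> E j"
    have "\<not> c < y"
    proof
      assume "c < y"
      then have "\<forall>\<^sub>F x in at_right c. x \<in> E j"
        unfolding eventually_at_right[OF \<open>c < y\<close>]
        using cE[of j] y Eint[of j] unfolding is_interval_1 by (blast intro: less_imp_le)
      with that show False by blast
    qed
    then show "y \<in> {l..c}" using y Esub by fastforce
  qed
  have left: "E j \<subseteq> {c..r}" if "\<not> (\<forall>\<^sub>F x in at_left c. x \<in> E j)" for j
  proof
    fix y assume y: "y \<in> E j"
    have "\<not> y < c"
    proof
      assume "y < c"
      then have "\<forall>\<^sub>F x in at_left c. x \<in> E j"
        unfolding eventually_at_left[OF \<open>y < c\<close>]
        using cE[of j] y Eint[of j] unfolding is_interval_1 by (blast intro: less_imp_le)
      with that show False by blast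
    qed
    then show "y \<in> {c..r}" using y Esub by fastforce
  qed
  \<comment> \<open>If every member carried the germ, so would their finite intersection. It is
    closed and invariant, hence everything, although \<open>C\<close> is proper.\<close>
  have not_all: "\<exists>j. \<not> (\<forall>\<^sub>F x in F. x \<in> E j)"
    if full: "\<And>Y. closed Y \<Longrightarrow> f ` Y \<subseteq> Y \<Longrightarrow> \<forall>\<^sub>F x in F. x \<in> Y \<Longrightarrow> {l..r} \<subseteq> Y" for F
  proof (rule ccontr)
    assume "\<not> ?thesis"
    then have "\<forall>\<^sub>F x in F. \<forall>j\<in>{..<k}. x \<in> E j" by (intro eventually_ball_finite) auto
    then have "\<forall>\<^sub>F x in F. x \<in> (\<Inter>j<k. E j)" by (rule eventually_mono) auto
    moreover have "f ` (\<Inter>j<k. E j) \<subseteq> (\<Inter>j<k. E j)"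
    proof clarify
      fix y j assume y: "y \<in> (\<Inter>j<k. E j)" and "j < k"
      define i where "i = (if j = 0 then k - 1 else j - 1)"
      have "i < k" "E (Suc i) = E j" using \<open>j < k\<close> Ek[of 0] by (auto simp: i_def)
      then show "f y \<in> E j" using y Einv[of i] by auto
    qed
    ultimately have "{l..r} \<subseteq> (\<Inter>j<k. E j)" using Ecl by (intro full) auto
    then have "{l..r} \<subseteq> E 0" using k by blast
    then show False using C E0 by auto
  qed
  have fullR: "{l..r} \<subseteq> Y" if "closed Y" "f ` Y \<subseteq> Y" "\<forall>\<^sub>F x in at_right c. x \<in> Y" for Y
    using closed_invariant_right_germ[OF that] c by simp
  have fullL: "{l..r} \<subseteq> Y" if "closed Y" "f ` Y \<subseteq> Y" "\<forall>\<^sub>F x in at_left c. x \<in> Y" for Y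
    using closed_invariant_left_germ[OF that] c by simp
  obtain jR where jR: "\<not> (\<forall>\<^sub>F x in at_right c. x \<in> E jR)" using not_all[OF fullR] by blast
  obtain jL where jL: "\<not> (\<forall>\<^sub>F x in at_left c. x \<in> E jL)" using not_all[OF fullL] by blast
  \<comment> \<open>\<open>E jL\<close> lies to the right of \<open>c\<close>; without the right
    germ it would also lie to the left and shrink to \<open>c\<close>.\<close>
  have jL': "\<forall>\<^sub>F x in at_right c. x \<in> E jL"
    using left[OF jL] right[of jL] nondeg[of jL] by (metis atLeastAtMost_iff order_antisym subsetD)
  have jR': "\<forall>\<^sub>F x in at_left c. x \<in> E jR"
    using right[OF jR] left[of jR] nondeg[of jR] by (metis atLeastAtMost_iff order_antisym subsetD)
  have "f x \<in> {l..c}" if "x \<in> {c..r}" for x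
  proof (cases "x = c")
    case False
    show ?thesis
      by (rule cycle_exchange[OF k Ek Ecl Einv right jL' jR fullR]) (use that False c in auto)
  qed (use c in auto)
  moreover have "f x \<in> {c..r}" if "x \<in> {l..c}" for x
  proof (cases "x = c")
    case False
    show ?thesis
      by (rule cycle_exchange[OF k Ek Ecl Einv left jR' jL fullL]) (use that False c in auto)
  qed (use c in auto)
  ultimately show ?thesis by blast
qed

section \<open>Covering and mixing without proper periodic intervals\<close>

definition no_proper_periodic_interval :: bool where
  "no_proper_periodic_interval \<longleftrightarrow> (\<forall>k C. k > 0 \<and> closed C \<and> is_interval C \<and> C \<subseteq> {l..r} \<and>
     (\<exists>u\<in>C. \<exists>v\<in>C. u < v) \<and> (f ^^ k) ` C \<subseteq> C \<longrightarrow> C = {l..r})"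

lemma periodic_point_covered_multiples:
  assumes "no_proper_periodic_interval" "is_interval U" "U \<subseteq> {l..r}" "u \<in> U" "v \<in> U" "u < v"
    and x: "x \<in> {l<..<r}" "(f ^^ k) x = x" "k > 0"
  shows "\<exists>N. \<forall>n\<ge>N. x \<in> (f ^^ (k * n)) ` U"
proof -
  have "{u..v} \<subseteq> U" using assms(2,4,5) by (metis atLeastAtMost_iff is_interval_1 subsetI)
  moreover have "l \<le> u" "v \<le> r" using assms(3-5) by auto
  then obtain z m where z: "z \<in> {u<..<v}" "m > 0" "(f ^^ m) z = z"
    using exists_periodic[OF _ assms(6)] by blast
  ultimately have zU: "z \<in> U" by auto
  \<comment> \<open>The factor \<open>m\<close> keeps \<open>z\<close> in every image, which makes
    the union connected; the factor \<open>k\<close> makes \<open>x\<close> fixed at all further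
    multiples of \<open>k\<close> once it is reached.\<close>
  define K where "K = (\<Union>n. (f ^^ (k * m * n)) ` U)"
  have zK: "z \<in> (f ^^ (k * m * n)) ` U" for n
    using funpow_periodic[OF z(3), of "k * n"] zU by (metis imageI mult.assoc mult.commute)
  have "connected K"
    unfolding K_def
  proof (rule connected_Union)
    show "connected s" if "s \<in> range (\<lambda>n. (f ^^ (k * m * n)) ` U)" for s
      using that assms(2,3) continuous_on_subset[OF funpow_cont]
      by (auto simp: is_interval_connected_1 intro!: connected_continuous_image)
    show "\<Inter> (range (\<lambda>n. (f ^^ (k * m * n)) ` U)) \<noteq> {}" using zK by blast
  qed
  have Ksub: "K \<subseteq> {l..r}" unfolding K_def using funpow_maps_image[OF assms(3)] by blast
  have clsub: "closure K \<subseteq> {l..r}" using Ksub by (intro closure_minimal) auto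
  have inv: "(f ^^ (k * m)) ` K \<subseteq> K"
  proof -
    have "(f ^^ (k * m)) ((f ^^ (k * m * n)) y) = (f ^^ (k * m * Suc n)) y" for y n
      by (simp only: funpow_funpow mult_Suc_right)
    then show ?thesis unfolding K_def by (auto simp del: mult_Suc_right)
  qed
  have "(f ^^ (k * m)) ` closure K \<subseteq> closure K"
    using inv closure_subset by (intro image_closure_subset continuous_on_subset[OF funpow_cont] clsub) auto
  moreover have "U \<subseteq> closure K"
  proof -
    have "(f ^^ (k * m * 0)) ` U = U" by simp
    then have "U \<subseteq> K" unfolding K_def by blast
    then show ?thesis using closure_subset by blast
  qed
  then have "\<exists>u\<in>closure K. \<exists>v\<in>closure K. u < v" using assms by blast
  moreover have "is_interval (closure K)"
    using \<open>connected K\<close> connected_imp_connected_closure is_interval_connected_1 by blast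
  ultimately have "closure K = {l..r}"
    using assms(1) x(3) z(2) clsub closed_closure unfolding no_proper_periodic_interval_def
    by (metis nat_0_less_mult_iff)
  \<comment> \<open>A convex set and its closure have the same interior, so \<open>x\<close> is in
    \<open>K\<close> itself and not merely a limit of it.\<close>
  moreover have "interior (closure K) = interior K"
    using \<open>connected K\<close> is_interval_connected_1 is_interval_convex convex_interior_closure by blast
  ultimately have "x \<in> interior K" using x(1) by simp
  then have "x \<in> K" using interior_subset by blast
  then obtain n0 w where w: "w \<in> U" "x = (f ^^ (k * m * n0)) w" unfolding K_def by auto
  have "x \<in> (f ^^ (k * n)) ` U" if "n \<ge> m * n0" for n
  proof -
    have "k * n = k * (n - m * n0) + k * m * n0"
      using that by (simp add: mult.assoc flip: distrib_left)
    then have "(f ^^ (k * n)) w = (f ^^ (k * (n - m * n0))) x"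
      by (simp only: w(2) funpow_funpow)
    then show ?thesis using funpow_periodic[OF x(2)] w(1) by (metis imageI)
  qed
  then show ?thesis by blast
qed

text \<open>To pass from multiples of \<open>k\<close> to all times, the previous lemma is applied
  to the images of \<open>U\<close> under \<open>f ^^ j\<close> for each residue
  \<open>j < k\<close>; these are still non-degenerate intervals.\<close>

lemma periodic_point_covered:
  assumes "no_proper_periodic_interval" "is_interval U" "U \<subseteq> {l..r}" "u \<in> U" "v \<in> U" "u < v"
    and x: "x \<in> {l<..<r}" "(f ^^ k) x = x" "k > 0"
  shows "\<exists>N. \<forall>n\<ge>N. x \<in> (f ^^ n) ` U"
proof -
  have "\<forall>\<^sub>F q in sequentially. x \<in> (f ^^ (k * q)) ` (f ^^ j) ` U" for j
  proof -
    obtain a b where ab: "a \<in> {u<..<v}" "b \<in> {u<..<v}" "(f ^^ j) a < (f ^^ j) b"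
      using funpow_image_nondegenerate[of u v j] assms by fastforce
    moreover have "{u..v} \<subseteq> U" using assms(2,4,5) by (metis atLeastAtMost_iff is_interval_1 subsetI)
    ultimately have "a \<in> U" "b \<in> U" by auto
    moreover have "is_interval ((f ^^ j) ` U)"
      using assms(2) connected_continuous_image[OF continuous_on_subset[OF funpow_cont assms(3)]]
      by (simp add: is_interval_connected_1)
    ultimately show ?thesis
      using periodic_point_covered_multiples[OF assms(1) _ funpow_maps_image[OF assms(3)] _ _ ab(3) x]
      unfolding eventually_sequentially by blast
  qed
  then have "\<forall>\<^sub>F q in sequentially. \<forall>j\<in>{..<k}. x \<in> (f ^^ (k * q)) ` (f ^^ j) ` U"
    by (intro eventually_ball_finite) auto
  then obtain N where N: "\<And>q j. q \<ge> N \<Longrightarrow> j < k \<Longrightarrow> x \<in> (f ^^ (k * q)) ` (f ^^ j) ` U"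
    unfolding eventually_sequentially by blast
  have "x \<in> (f ^^ n) ` U" if "n \<ge> k * N" for n
  proof -
    have "n div k \<ge> N" using that x(3) by (simp add: less_eq_div_iff_mult_less_eq mult.commute)
    then have "x \<in> (f ^^ (k * (n div k))) ` (f ^^ (n mod k)) ` U" using N x(3) by simp
    then obtain w where "w \<in> U" "x = (f ^^ (k * (n div k))) ((f ^^ (n mod k)) w)" by blast
    then show ?thesis by (simp add: funpow_funpow)
  qed
  then show ?thesis by blast
qed

text \<open>Late images are intervals containing a periodic point near each endpoint, hence
  everything in between.\<close>

lemma eventually_covers:
  assumes "no_proper_periodic_interval" "is_interval U" "U \<subseteq> {l..r}" "u \<in> U" "v \<in> U" "u < v" "\<eta> > 0"
  shows "\<exists>n0. \<forall>n>n0. {l + \<eta>..r - \<eta>} \<subseteq> (f ^^ n) ` U"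
proof -
  obtain x k where x: "x \<in> {l<..<min r (l + \<eta>)}" "k > 0" "(f ^^ k) x = x"
    using exists_periodic[of l "min r (l + \<eta>)"] less assms by auto
  obtain y m where y: "y \<in> {max l (r - \<eta>)<..<r}" "m > 0" "(f ^^ m) y = y"
    using exists_periodic[of "max l (r - \<eta>)" r] less assms by auto
  obtain N where N: "\<And>n. n \<ge> N \<Longrightarrow> x \<in> (f ^^ n) ` U"
    using periodic_point_covered[OF assms(1-6) _ x(3,2)] x(1) by auto
  obtain M where M: "\<And>n. n \<ge> M \<Longrightarrow> y \<in> (f ^^ n) ` U"
    using periodic_point_covered[OF assms(1-6) _ y(3,2)] y(1) by auto
  have "{l + \<eta>..r - \<eta>} \<subseteq> (f ^^ n) ` U" if "n > max N M" for n
  proof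
    fix z assume z: "z \<in> {l + \<eta>..r - \<eta>}"
    have "is_interval ((f ^^ n) ` U)"
      using assms(2) connected_continuous_image[OF continuous_on_subset[OF funpow_cont assms(3)]]
      by (simp add: is_interval_connected_1)
    moreover have "x \<in> (f ^^ n) ` U" "y \<in> (f ^^ n) ` U" using N[of n] M[of n] that by auto
    moreover have "x \<le> z" "z \<le> y" using x(1) y(1) z by auto
    ultimately show "z \<in> (f ^^ n) ` U" unfolding is_interval_1 by blast
  qed
  then show ?thesis by blast
qed

lemma mixing:
  assumes "no_proper_periodic_interval"
  shows "mixing_on {l..r} f"
  unfolding mixing_on_def
proof (intro allI impI, elim conjE)
  fix U V assume U: "openin (top_of_set {l..r}) U" "U \<noteq> {}" and V: "openin (top_of_set {l..r}) V" "V \<noteq> {}"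
  obtain u v where uv: "u < v" "{u..v} \<subseteq> U" "l \<le> u" "v \<le> r"
    using openin_interval_contains_interval[OF U less] .
  obtain p q where pq: "p < q" "{p..q} \<subseteq> V" "l \<le> p" "q \<le> r"
    using openin_interval_contains_interval[OF V less] .
  define m where "m = (p + q) / 2"
  have m: "p < m" "m < q" using pq by (auto simp: m_def)
  then have "m \<in> V" using pq(2) by auto
  \<comment> \<open>With the distance from \<open>m\<close> to the nearer endpoint as
    \<open>\<eta>\<close>, the covered interval contains \<open>m\<close>.\<close>
  obtain N where N: "\<And>n. n > N \<Longrightarrow> {l + min (m - l) (r - m)..r - min (m - l) (r - m)} \<subseteq> (f ^^ n) ` {u..v}"
    using eventually_covers[OF assms, of "{u..v}" u v "min (m - l) (r - m)"] uv pq m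
    by (auto simp: is_interval_cc)
  have "(f ^^ n) ` U \<inter> V \<noteq> {}" if "n > N" for n
  proof -
    have "m \<in> (f ^^ n) ` {u..v}" using N[OF that] by force
    then show ?thesis using uv(2) \<open>m \<in> V\<close> by blast
  qed
  then show "\<exists>N. \<forall>n>N. (f ^^ n) ` U \<inter> V \<noteq> {}" by blast
qed

section \<open>The dichotomy and the second iterate\<close>

lemma no_proper_periodic_interval_or_exchange:
  "no_proper_periodic_interval \<or>
   (\<exists>c. l < c \<and> c < r \<and> f c = c \<and> f ` {l..c} \<subseteq> {c..r} \<and> f ` {c..r} \<subseteq> {l..c})"
proof (cases no_proper_periodic_interval)
  case False
  then obtain k C u v where C: "k > 0" "closed C" "is_interval C" "C \<subseteq> {l..r}" "C \<noteq> {l..r}"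
      "u < v" "u \<in> C" "v \<in> C" "(f ^^ k) ` C \<subseteq> C"
    unfolding no_proper_periodic_interval_def by blast
  obtain c where c: "l < c" "c < r" "f c = c" using interior_fixed_point by blast
  show ?thesis using periodic_interval_exchange[OF C c] c by blast
qed simp

text \<open>An exchange moves both endpoints across an interior point, so it fixes neither.\<close>

lemma no_proper_periodic_interval_if_fixed_endpoint:
  assumes "f l = l \<or> f r = r"
  shows "no_proper_periodic_interval"
proof (rule ccontr)
  assume "\<not> ?thesis"
  then obtain c where c: "l < c" "c < r" "f ` {l..c} \<subseteq> {c..r}" "f ` {c..r} \<subseteq> {l..c}"
    using no_proper_periodic_interval_or_exchange by blast
  then have "f l \<in> {c..r}" "f r \<in> {l..c}" by (simp_all add: image_subset_iff)
  with assms c show False by auto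
qed

text \<open>Preimages exist because \<open>f\<close> is onto; one on the wrong side forces the value
  \<open>c\<close>, which is its own preimage.\<close>

lemma exchange_surj:
  assumes "l < c" "c < r" "f c = c" "f ` {l..c} \<subseteq> {c..r}" "f ` {c..r} \<subseteq> {l..c}"
  shows "f ` {l..c} = {c..r}" "f ` {c..r} = {l..c}"
proof -
  have *: "\<exists>x\<in>{l..c}. y = f x" if "y \<in> {c..r}" for y
  proof -
    have "y \<in> f ` {l..r}" using that assms(1,2) by (simp add: surj)
    then obtain x where x: "x \<in> {l..r}" "y = f x" by blast
    show ?thesis
    proof (cases "x \<le> c")
      case False
      then have "y \<in> {l..c}" using x assms(5) by (simp add: image_subset_iff)
      then have "y = c" using that by auto
      then show ?thesis using assms(1-3) by (intro bexI[of _ c]) auto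
    qed (use x in auto)
  qed
  have **: "\<exists>x\<in>{c..r}. y = f x" if "y \<in> {l..c}" for y
  proof -
    have "y \<in> f ` {l..r}" using that assms(1,2) by (simp add: surj)
    then obtain x where x: "x \<in> {l..r}" "y = f x" by blast
    show ?thesis
    proof (cases "c \<le> x")
      case False
      then have "y \<in> {c..r}" using x assms(4) by (simp add: image_subset_iff)
      then have "y = c" using that by auto
      then show ?thesis using assms(1-3) by (intro bexI[of _ c]) auto
    qed (use x in auto)
  qed
  show "f ` {l..c} = {c..r}" "f ` {c..r} = {l..c}" using assms(4,5) * ** by blast+
qed

text \<open>Once the orbit is inside \<open>{p<..<q}\<close>, it avoids this open interval at all
  odd later times, so its visits there occur at even times and are visits under
  \<open>f ^^ 2\<close>.\<close>

lemma square_transitive: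
  assumes pq: "l \<le> p" "p < q" "q \<le> r"
    and inv: "(f ^^ 2) ` {p..q} \<subseteq> {p..q}" and out: "\<And>x. x \<in> {p..q} \<Longrightarrow> f x \<notin> {p<..<q}"
  shows "\<exists>x1. transitive_interval_map (f ^^ 2) p q x1"
proof -
  obtain N0 where N0: "(f ^^ N0) x0 \<in> {p<..<q}" using visits[OF pq, of 0] by auto
  define x1 where "x1 = (f ^^ N0) x0"
  have even_in: "(f ^^ (2 * i)) x1 \<in> {p..q}" for i
  proof (induction i)
    case (Suc i)
    have "(f ^^ (2 * Suc i)) x1 = (f ^^ 2) ((f ^^ (2 * i)) x1)"
      by (simp only: funpow_funpow mult_Suc_right)
    then show ?case using Suc inv by (metis image_subset_iff)
  qed (use N0 in \<open>auto simp: x1_def\<close>)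
  have "transitive_interval_map (f ^^ 2) p q x1"
  proof
    show "continuous_on {p..q} (f ^^ 2)" using funpow_cont by (rule continuous_on_subset) (use pq in auto)
    show "x1 \<in> {p..q}" using N0 by (auto simp: x1_def)
    fix u v :: real and N :: nat
    assume uv: "p \<le> u" "u < v" "v \<le> q"
    \<comment> \<open>Subtracting \<open>N0\<close> and halving must leave at least
      \<open>N\<close>.\<close>
    obtain n where n: "n \<ge> N0 + 2 * N" "(f ^^ n) x0 \<in> {u<..<v}"
      using visits[of u v "N0 + 2 * N"] uv pq by auto
    define d where "d = n - N0"
    have d: "(f ^^ d) x1 \<in> {u<..<v}" "d \<ge> 2 * N" using n by (auto simp: d_def x1_def funpow_funpow)
    have "even d"
    proof (rule ccontr)
      assume "odd d"
      then obtain i where "d = Suc (2 * i)" by (metis oddE Suc_eq_plus1)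
      then have "f ((f ^^ (2 * i)) x1) \<in> {u<..<v}" using d by simp
      then have "f ((f ^^ (2 * i)) x1) \<in> {p<..<q}" using uv by auto
      then show False using out[OF even_in] by blast
    qed
    then obtain i where "d = 2 * i" by auto
    then show "\<exists>n\<ge>N. ((f ^^ 2) ^^ n) x1 \<in> {u<..<v}"
      using d by (intro exI[of _ i]) (simp add: funpow_mult mult.commute)
  qed (use pq inv in auto)
  then show ?thesis by blast
qed

end

section \<open>The omega-limit set, failure of mixing, and the theorem\<close>

text \<open>The midpoint of each subinterval is a limit along the orbit, which gives arbitrarily
  late visits.\<close>

lemma transitive_interval_map_if_transitive_on:
  fixes f :: "real \<Rightarrow> real"
  assumes "l < r" "continuous_on {l..r} f" "f ` {l..r} \<subseteq> {l..r}" "transitive_on {l..r} f"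
  shows "\<exists>x0. transitive_interval_map f l r x0"
proof -
  obtain x0 where x0: "x0 \<in> {l..r}" "omega_limit f x0 = {l..r}"
    using assms(4) by (auto simp: transitive_on_def)
  have "transitive_interval_map f l r x0"
  proof
    fix u v :: real and N :: nat
    assume uv: "l \<le> u" "u < v" "v \<le> r"
    then have "(u + v) / 2 \<in> omega_limit f x0" using x0 by auto
    then obtain s :: "nat \<Rightarrow> nat" where s: "strict_mono s" "(\<lambda>k. (f ^^ s k) x0) \<longlonglongrightarrow> (u + v) / 2"
      by (auto simp: omega_limit_def)
    have "\<forall>\<^sub>F k in sequentially. (f ^^ s k) x0 \<in> {u<..<v}"
      using s(2) by (rule topological_tendstoD) (use uv in auto)
    moreover have "\<forall>\<^sub>F k in sequentially. s k \<ge> N"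
      using s(1) filterlim_subseq filterlim_at_top by blast
    ultimately have "\<forall>\<^sub>F k in sequentially. s k \<ge> N \<and> (f ^^ s k) x0 \<in> {u<..<v}"
      by eventually_elim simp
    then show "\<exists>n\<ge>N. (f ^^ n) x0 \<in> {u<..<v}"
      using eventually_happens' sequentially_bot by blast
  qed (use assms x0 in auto)
  then show ?thesis by blast
qed

text \<open>Even iterates keep the left side on the left, so at arbitrarily late times it misses the
  open right side.\<close>

lemma not_mixing_if_exchange:
  fixes f :: "real \<Rightarrow> real"
  assumes "l < c" "c < r" "f ` {l..c} \<subseteq> {c..r}" "f ` {c..r} \<subseteq> {l..c}"
  shows "\<not> mixing_on {l..r} f"
proof
  assume "mixing_on {l..r} f"
  moreover have "openin (top_of_set {l..r}) ({l..r} \<inter> {..<c})" "openin (top_of_set {l..r}) ({l..r} \<inter> {c<..})"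
    by (intro openin_open_Int open_lessThan open_greaterThan)+
  moreover have "l \<in> {l..r} \<inter> {..<c}" "r \<in> {l..r} \<inter> {c<..}" using assms by auto
  ultimately obtain N where N: "\<And>n. n > N \<Longrightarrow> (f ^^ n) ` ({l..r} \<inter> {..<c}) \<inter> ({l..r} \<inter> {c<..}) \<noteq> {}"
    unfolding mixing_on_def by (metis empty_iff)
  have "(f ^^ (2 * n)) x \<in> {l..c}" if "x \<in> {l..c}" for n x
    using that
  proof (induction n)
    case (Suc n)
    then have "f ((f ^^ (2 * n)) x) \<in> {c..r}" using assms(3) by blast
    then have "f (f ((f ^^ (2 * n)) x)) \<in> {l..c}" using assms(4) by blast
    then show ?case by simp
  qed simp
  then have "(f ^^ (2 * Suc N)) ` ({l..r} \<inter> {..<c}) \<subseteq> {l..c}" by (auto simp del: mult_Suc_right)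
  then show False using N[of "2 * Suc N"] by fastforce
qed

theorem lemma8p3:
  fixes f :: "real \<Rightarrow> real"
  assumes "continuous_on {0..1} f"
    and "f ` {0..1} \<subseteq> {0..1}"
    and "transitive_on {0..1} f"
  shows "((mixing_on {0..1} f \<and>
           (\<forall>\<eta>>0. \<forall>U. is_interval U \<and> U \<subseteq> {0..1} \<and> (\<exists>x\<in>U. \<exists>y\<in>U. x \<noteq> y) \<longrightarrow>
              (\<exists>n0::nat. \<forall>n>n0. {\<eta>..1 - \<eta>} \<subseteq> (f ^^ n) ` U)))
          \<or>
          (\<not> mixing_on {0..1} f \<and>
           (\<exists>a. 0 < a \<and> a < 1 \<and> f a = a \<and>
              f ` {0..a} = {a..1} \<and> f ` {a..1} = {0..a} \<and>
              mixing_on {0..a} (f ^^ 2) \<and> mixing_on {a..1} (f ^^ 2))))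
         \<and> closure (periodic_points {0..1} f) = {0..1}"
proof -
  obtain x0 where "transitive_interval_map f 0 1 x0"
    using transitive_interval_map_if_transitive_on assms by fastforce
  then interpret transitive_interval_map f 0 1 x0 .
  show ?thesis
  proof (cases no_proper_periodic_interval)
    case True
    have "\<exists>n0. \<forall>n>n0. {\<eta>..1 - \<eta>} \<subseteq> (f ^^ n) ` U"
      if "\<eta> > 0" "is_interval U" "U \<subseteq> {0..1}" "x \<in> U" "y \<in> U" "x \<noteq> y" for \<eta> U x y
      using eventually_covers[OF True that(2,3), of x y \<eta>] eventually_covers[OF True that(2,3), of y x \<eta>] that
      by (cases x y rule: linorder_cases) auto
    then show ?thesis using mixing[OF True] closure_periodic_points by blast
  next
    case False
    then obtain c where c: "0 < c" "c < 1" "f c = c" "f ` {0..c} \<subseteq> {c..1}" "f ` {c..1} \<subseteq> {0..c}"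
      using no_proper_periodic_interval_or_exchange by blast
    have sq: "(f ^^ 2) ` A = f ` f ` A" for A by (auto simp: numeral_2_eq_2)
    have f2c: "(f ^^ 2) c = c" using c by (simp add: numeral_2_eq_2)
    have "\<exists>x1. transitive_interval_map (f ^^ 2) 0 c x1"
    proof (rule square_transitive)
      fix x assume "x \<in> {0..c}"
      then have "f x \<in> {c..1}" using c(4) by blast
      then show "f x \<notin> {0<..<c}" by simp
    next
      show "(f ^^ 2) ` {0..c} \<subseteq> {0..c}" unfolding sq using c(4,5) by blast
    qed (use c in auto)
    then obtain x1 where x1: "transitive_interval_map (f ^^ 2) 0 c x1" ..
    have "\<exists>x2. transitive_interval_map (f ^^ 2) c 1 x2"
    proof (rule square_transitive)
      fix x assume "x \<in> {c..1}"
      then have "f x \<in> {0..c}" using c(5) by blast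
      then show "f x \<notin> {c<..<1}" by simp
    next
      show "(f ^^ 2) ` {c..1} \<subseteq> {c..1}" unfolding sq using c(4,5) by blast
    qed (use c in auto)
    then obtain x2 where x2: "transitive_interval_map (f ^^ 2) c 1 x2" ..
    \<comment> \<open>The point \<open>c\<close> is an endpoint of both halves and fixed by
      \<open>f ^^ 2\<close>, so neither half admits a further exchange.\<close>
    have "mixing_on {0..c} (f ^^ 2)" "mixing_on {c..1} (f ^^ 2)"
      using transitive_interval_map.mixing transitive_interval_map.no_proper_periodic_interval_if_fixed_endpoint
        x1 x2 f2c by blast+
    then show ?thesis
      using c exchange_surj[OF c] not_mixing_if_exchange[OF c(1,2,4,5)] closure_periodic_points by blast
  qed
qed

end
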